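(* Let $\Gamma$ be a negative definite plumbing tree with $s$ vertices. For every $\mathrm{spin}^c$ structure $[k]\in(m+2\mathbb{Z}^s)/2M\mathbb{Z}^s$, $\widehat{\widehat{Z}}_{[k]}(q,t)=\widehat{\widehat{Z}}_{[-k]}(q,t^{-1})$. In particular, setting $t=1$ recovers the conjugation invariance of $\widehat Z$: $\widehat Z_{k-Mu}(q)=\widehat Z_{-k-Mu}(q)$.
   Context: A plumbing tree $\Gamma$ is a finite tree with vertices $v_1,\dots,v_s$ and integer weights $m_i=m(v_i)$. Let $\delta_v$ be the degree of $v$, $m=(m_1,\dots,m_s)$, $\delta=(\delta_{v_1},\dots,\delta_{v_s})$. The matrix $M$ is the symmetric $s\times s$ matrix with $M_{ii}=m_i$, $M_{ij}=1$ if $i\ne j$ and $v_i,v_j$ are adjacent, and $0$ otherwise. $\Gamma$ is negative definite if $M$ is. Write $\langle x,y\rangle=x^tMy$, $\cdot$ for the dot product, $u=(1,\dots,1)$ (so $Mu=m+\delta$), and $(k-Mu)^2:=(k-Mu)^tM^{-1}(k-Mu)$. $\mathrm{Spin}^c$ structures on the plumbed $3$-manifold $Y(\Gamma)$ are identified with classes $[k]\in(m+2\mathbb{Z}^s)/2M\mathbb{Z}^s$; conjugation of $\mathrm{spin}^c$ structures is $[k]\mapsto[-k]$. For $0\le n\le2$, $\widehat F_n(r)$ is the coefficient of $z^{-r}$ in $(z-z^{-1})^{2-n}$. For $n\ge3$, $\widehat F_n(r)$ is the average of the coefficients of $z^{-r}$ in $\big(-\sum_{i\ge0}z^{2i+1}\big)^{n-2}$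 and in $\big(\sum_{i\ge0}z^{-(2i+1)}\big)^{n-2}$. Put $\widehat F_{\Gamma,k}(x)=\prod_v\widehat F_{\delta_v}\big((2Mx+k-Mu)_v\big)$ for $x\in\mathbb{Z}^s$, the product over all vertices $v$. Let $\chi_k(x)=-(k\cdot x+\langle x,x\rangle)/2$, $\Delta_k=-\frac{(k-Mu)^2+3s+\sum_v m_v}{4}$, $\Theta_k=\frac{k\cdot u-\langle u,u\rangle}{2}$, $\varepsilon_k(x)=\Delta_k+2\chi_k(x)+\langle x,u\rangle$, $\theta_k(x)=\Theta_k+\langle x,u\rangle$. The series $\widehat{\widehat{Z}}_{[k]}(q,t)$ is the coefficientwise limit (each coefficient being eventually constant) as $n\to\infty$ of the finite sums $\sum_{x\in\mathbb{Z}^s,\ \chi_k(x)\le n}\widehat F_{\Gamma,k}(x)q^{\varepsilon_k(x)}t^{\theta_k(x)}$; equivalently $\widehat{\widehat{Z}}_{[k]}(q,t)=\sum_{x\in\mathbb{Z}^s}\widehat F_{\Gamma,k}(x)q^{\varepsilon_k(x)}t^{\theta_k(x)}$ for any $k\in[k]$ (independent of the representative). For $a\in\delta+2\mathbb{Z}^s$, $$\widehat Z_a(q)=q^{-\frac{3s+\sum_v m_v}{4}}\sum_{\ell\in a+2M\mathbb{Z}^s}\Big[\prod_v \mathrm{v.p.}\frac{1}{2\pi i}\oint_{|z_v|=1}\frac{1}{z_v}\Big(z_v-\frac1{z_v}\Big)^{2-\delta_v}z_v^{\ell_v}\,dz_v\Big]q^{-\frac{\ell^tM^{-1}\ell}{4}},$$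 where v.p. denotes the average of the integrals over $|z_v|=1+\epsilon$ and $|z_v|=1-\epsilon$ for small $\epsilon>0$. The $\widehat Z$-invariant of $(Y(\Gamma),[k])$ is $\widehat Z_{k-Mu}(q)$. *)

theory Defs
  imports
    "HOL-Complex_Analysis.Complex_Analysis"
    "HOL-Computational_Algebra.Formal_Laurent_Series"
begin

section \<open>Plumbing trees\<close>

text \<open>
  The vertices form a finite type; its cardinality is the number \<open>s\<close>. A tree is a simple graph,
  given by its adjacency relation, that is connected and has no cycle of length at least three.
\<close>

definition graph_cycle :: "('v \<Rightarrow> 'v \<Rightarrow> bool) \<Rightarrow> 'v list \<Rightarrow> bool" where
  "graph_cycle adj c \<longleftrightarrow> length c \<ge> 3 \<and> distinct c \<and>
     (\<forall>i < length c. adj (c ! i) (c ! (Suc i mod length c)))"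

definition tree_adjacency :: "('v::finite \<Rightarrow> 'v \<Rightarrow> bool) \<Rightarrow> bool" where
  "tree_adjacency adj \<longleftrightarrow> symp adj \<and> irreflp adj \<and> (\<forall>v w. rtranclp adj v w) \<and>
     (\<nexists>c. graph_cycle adj c)"

definition vertex_degree :: "('v::finite \<Rightarrow> 'v \<Rightarrow> bool) \<Rightarrow> 'v \<Rightarrow> nat" where
  "vertex_degree adj v = card {w. adj v w}"

definition plumbing_matrix :: "('v::finite \<Rightarrow> 'v \<Rightarrow> bool) \<Rightarrow> int^'v \<Rightarrow> int^'v^'v" where
  "plumbing_matrix adj m = (\<chi> i j. if i = j then m $ i else if adj i j then 1 else 0)"

definition real_vec :: "int^'v \<Rightarrow> real^'v" where
  "real_vec x = (\<chi> i. real_of_int (x $ i))"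

definition real_mat :: "int^'v^'v \<Rightarrow> real^'v^'v" where
  "real_mat A = map_matrix real_of_int A"

definition negative_definite :: "int^'v^'v \<Rightarrow> bool" where
  "negative_definite A \<longleftrightarrow> (\<forall>x::real^'v. x \<noteq> 0 \<longrightarrow> x \<bullet> (real_mat A *v x) < 0)"

definition dot :: "int^'v \<Rightarrow> int^'v \<Rightarrow> int" (infixl "\<cdot>" 70) where
  "x \<cdot> y = (\<Sum>i\<in>UNIV. x $ i * y $ i)"

definition form :: "int^'v^'v \<Rightarrow> int^'v \<Rightarrow> int^'v \<Rightarrow> int" where
  "form A x y = x \<cdot> (A *v y)"

definition inv_square :: "int^'v^'v \<Rightarrow> int^'v \<Rightarrow> real" where
  "inv_square A y = real_vec y \<bullet> (matrix_inv (real_mat A) *v real_vec y)"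

definition characteristic_vectors :: "int^'v \<Rightarrow> (int^'v) set" where
  "characteristic_vectors m = {m + 2 *s n | n. True}"

text \<open>The coset \<open>a + 2 M \<int>\<^sup>s\<close>; for characteristic \<open>a\<close> this is a spin-c structure.\<close>

definition coset2 :: "int^'v^'v \<Rightarrow> int^'v \<Rightarrow> (int^'v) set" where
  "coset2 A a = {a + 2 *s (A *v n) | n. True}"

section \<open>The coefficients of the two-variable series\<close>

definition odd_series :: "complex fls" where
  "odd_series = fps_to_fls (Abs_fps (\<lambda>j. if odd j then 1 else 0))"

text \<open>
  In the last clause, the first summand is read off from a Laurent series in \<open>z\<close>. The second one
  comes from a power series in \<open>w = z\<^sup>-\<^sup>1\<close>, so that the coefficient of \<open>z\<^sup>-\<^sup>r\<close> is that of \<open>w\<^sup>r\<close>.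
\<close>

definition F_hat :: "nat \<Rightarrow> int \<Rightarrow> complex" where
  "F_hat n r =
     (if n \<le> 2 then fls_nth ((fls_X - fls_X_inv) ^ (2 - n)) (- r)
      else (fls_nth ((- odd_series) ^ (n - 2)) (- r) + fls_nth (odd_series ^ (n - 2)) r) / 2)"

text \<open>The value that \<open>f\<close> eventually takes along the filter \<open>F\<close>, if it is eventually constant.\<close>

definition eventual_value :: "'a filter \<Rightarrow> ('a \<Rightarrow> 'b) \<Rightarrow> 'b" where
  "eventual_value F f = (THE c. \<forall>\<^sub>F x in F. f x = c)"

text \<open>
  Formal series are given by their coefficients, as functions of the exponents of \<open>q\<close> and \<open>t\<close>.
  The coefficients lie in \<open>\<complex>\<close> so as to accommodate the contour integrals below.
\<close>

type_synonym q_series = "real \<Rightarrow> complex"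
type_synonym qt_series = "real \<Rightarrow> real \<Rightarrow> complex"

definition subst_t_inverse :: "qt_series \<Rightarrow> qt_series" where
  "subst_t_inverse Z = (\<lambda>a b. Z a (- b))"

definition subst_t_one :: "qt_series \<Rightarrow> q_series" where
  "subst_t_one Z = (\<lambda>a. \<Sum>b | Z a b \<noteq> 0. Z a b)"

definition principal_value_coeff :: "nat \<Rightarrow> int \<Rightarrow> complex" where
  "principal_value_coeff n l =
     (let I = (\<lambda>r. 1 / (2 * of_real pi * \<i>) *
                 contour_integral (circlepath 0 r)
                   (\<lambda>z. 1 / z * (z - 1 / z) powi (2 - int n) * z powi l))
      in eventual_value (at_right (0::real)) (\<lambda>\<epsilon>. (I (1 + \<epsilon>) + I (1 - \<epsilon>)) / 2))"

context
  fixes adj :: "'v::finite \<Rightarrow> 'v \<Rightarrow> bool" and m :: "int^'v"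
begin

private abbreviation (input) "M \<equiv> plumbing_matrix adj m"
private abbreviation (input) "u \<equiv> (1 :: int^'v)"

definition F_plumbing :: "int^'v \<Rightarrow> int^'v \<Rightarrow> complex" where
  "F_plumbing k x =
     (\<Prod>v\<in>UNIV. F_hat (vertex_degree adj v) ((2 *s (M *v x) + k - M *v u) $ v))"

definition chi :: "int^'v \<Rightarrow> int^'v \<Rightarrow> real" where
  "chi k x = - real_of_int (k \<cdot> x + form M x x) / 2"

definition Delta :: "int^'v \<Rightarrow> real" where
  "Delta k = - (inv_square M (k - M *v u) + 3 * real CARD('v) + (\<Sum>v\<in>UNIV. real_of_int (m $ v))) / 4"

definition Theta :: "int^'v \<Rightarrow> real" where
  "Theta k = real_of_int (k \<cdot> u - form M u u) / 2"

definition q_exponent :: "int^'v \<Rightarrow> int^'v \<Rightarrow> real" where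
  "q_exponent k x = Delta k + 2 * chi k x + real_of_int (form M x u)"

definition t_exponent :: "int^'v \<Rightarrow> int^'v \<Rightarrow> real" where
  "t_exponent k x = Theta k + real_of_int (form M x u)"

definition Z_hat_hat_partial :: "int^'v \<Rightarrow> nat \<Rightarrow> qt_series" where
  "Z_hat_hat_partial k n a b =
     (\<Sum>x | chi k x \<le> real n \<and> q_exponent k x = a \<and> t_exponent k x = b. F_plumbing k x)"

definition Z_hat_hat_rep :: "int^'v \<Rightarrow> qt_series" where
  "Z_hat_hat_rep k a b = eventual_value sequentially (\<lambda>n. Z_hat_hat_partial k n a b)"

definition Z_hat_hat :: "(int^'v) set \<Rightarrow> qt_series" where
  "Z_hat_hat K = Z_hat_hat_rep (SOME k. k \<in> K)"

definition Z_hat :: "int^'v \<Rightarrow> q_series" where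
  "Z_hat a e =
     (\<Sum>l | l \<in> coset2 M a \<and>
          - (3 * real CARD('v) + (\<Sum>v\<in>UNIV. real_of_int (m $ v))) / 4 - inv_square M l / 4 = e.
        \<Prod>v\<in>UNIV. principal_value_coeff (vertex_degree adj v) (l $ v))"

end

section \<open>Well-definedness\<close>

lemma finite_bounded_int_vec: "finite {x::int^'v. \<forall>i. \<bar>x $ i\<bar> \<le> B}"
proof -
  have "{x::int^'v. \<forall>i. \<bar>x $ i\<bar> \<le> B} \<subseteq> vec_lambda ` (UNIV \<rightarrow>\<^sub>E {-B..B})"
  proof
    fix x :: "int^'v" assume "x \<in> {x. \<forall>i. \<bar>x $ i\<bar> \<le> B}"
    then have "vec_nth x \<in> UNIV \<rightarrow>\<^sub>E {-B..B}" by (auto simp: abs_le_iff minus_le_iff)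
    then show "x \<in> vec_lambda ` (UNIV \<rightarrow>\<^sub>E {-B..B})" by (metis image_eqI vec_nth_inverse)
  qed
  moreover have "finite (vec_lambda ` ((UNIV::'v set) \<rightarrow>\<^sub>E {-B..B}))"
    by (intro finite_imageI finite_PiE) auto
  ultimately show ?thesis by (rule finite_subset)
qed

lemma real_vec_mult: "real_vec (A *v x) = real_mat A *v real_vec x"
  by (simp add: real_vec_def real_mat_def map_matrix_def matrix_vector_mult_def)

lemma dot_real: "real_of_int (x \<cdot> y) = real_vec x \<bullet> real_vec y"
  by (simp add: dot_def real_vec_def inner_vec_def)

lemma form_real: "real_of_int (form A x y) = real_vec x \<bullet> (real_mat A *v real_vec y)"
  by (simp add: form_def dot_real real_vec_mult)

lemma negative_definite_coercive:
  fixes A :: "int^'v^'v"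
  assumes "negative_definite A"
  obtains d where "d > 0" "\<And>x::real^'v. x \<bullet> (real_mat A *v x) \<le> - d * (norm x)\<^sup>2"
proof -
  let ?f = "\<lambda>x::real^'v. x \<bullet> (real_mat A *v x)"
  have "\<exists>y\<in>sphere (0::real^'v) 1. \<forall>x\<in>sphere 0 1. ?f x \<le> ?f y"
  proof (rule continuous_attains_sup)
    show "sphere (0::real^'v) 1 \<noteq> {}"
      using vector_choose_size[of 1, where 'a = "real^'v"] by (auto simp: sphere_def)
    show "continuous_on (sphere 0 1) ?f"
      by (intro continuous_intros linear_continuous_on) (simp add: linear_linear)
  qed auto
  then obtain y where y: "norm y = 1" "\<And>x. norm x = 1 \<Longrightarrow> ?f x \<le> ?f y"
    by (auto simp: sphere_def)
  have "?f x \<le> - (- ?f y) * (norm x)\<^sup>2" for x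
  proof (cases "x = 0")
    case False
    let ?n = "(1 / norm x) *\<^sub>R x"
    have "?f ?n \<le> ?f y" by (rule y(2)) (use False in simp)
    moreover have "?f ?n = ?f x / (norm x)\<^sup>2"
      by (simp add: matrix_vector_mult_scaleR power2_eq_square)
    ultimately have "?f x / (norm x)\<^sup>2 \<le> ?f y" by linarith
    then show ?thesis using False by (simp add: pos_divide_le_eq)
  qed simp
  moreover have "- ?f y > 0" using assms y(1) unfolding negative_definite_def
    by (metis neg_0_less_iff_less norm_zero zero_neq_one)
  ultimately show ?thesis using that by blast
qed

lemma finite_form_sublevel:
  fixes A :: "int^'v^'v"
  assumes "negative_definite A"
  shows "finite {x::int^'v. real_vec x \<bullet> b - real_of_int (form A x x) \<le> c}"
proof -
  obtain d where d: "d > 0" "\<And>x::real^'v. x \<bullet> (real_mat A *v x) \<le> - d * (norm x)\<^sup>2"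
    using negative_definite_coercive[OF assms] by blast
  define R where "R = (norm b + \<bar>c\<bar>) / d + 1"
  have "{x::int^'v. real_vec x \<bullet> b - real_of_int (form A x x) \<le> c} \<subseteq> {x. \<forall>i. \<bar>x $ i\<bar> \<le> \<lceil>R\<rceil>}"
  proof clarify
    fix x :: "int^'v" and i assume x: "real_vec x \<bullet> b - real_of_int (form A x x) \<le> c"
    let ?r = "norm (real_vec x)"
    have "- (real_vec x \<bullet> b) \<le> ?r * norm b" using Cauchy_Schwarz_ineq2[of "real_vec x" b] by linarith
    then have *: "d * ?r\<^sup>2 \<le> \<bar>c\<bar> + ?r * norm b"
      using x d(2)[of "real_vec x"] by (auto simp: form_real)
    have "?r \<le> R"
    proof (rule ccontr)
      assume "\<not> ?r \<le> R"
      then have r: "?r > R" by simp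
      have "R \<ge> 1" using d(1) by (auto simp: R_def)
      then have r1: "?r > 1" using r by linarith
      have "\<bar>c\<bar> + ?r * norm b \<le> ?r * (\<bar>c\<bar> + norm b)"
        using mult_right_mono[of 1 ?r "\<bar>c\<bar>"] r1 by (simp add: algebra_simps)
      also have "\<dots> = ?r * (d * (R - 1))" using d(1) by (simp add: R_def)
      also have "\<dots> < ?r * (d * ?r)" using r r1 d(1) by (intro mult_strict_left_mono) auto
      also have "\<dots> = d * ?r\<^sup>2" by (simp add: power2_eq_square)
      finally show False using * by simp
    qed
    moreover have "\<bar>real_of_int (x $ i)\<bar> \<le> ?r"
      using component_le_norm_cart[of "real_vec x" i] by (simp add: real_vec_def)
    ultimately show "\<bar>x $ i\<bar> \<le> \<lceil>R\<rceil>" by linarith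
  qed
  then show ?thesis using finite_bounded_int_vec finite_subset by blast
qed

lemma finite_chi_sublevel:
  assumes "negative_definite (plumbing_matrix adj m)"
  shows "finite {x. chi adj m k x \<le> c}"
proof -
  have "{x. chi adj m k x \<le> c} \<subseteq>
      {x. real_vec x \<bullet> (- real_vec k) - real_of_int (form (plumbing_matrix adj m) x x) \<le> 2 * c}"
    by (auto simp: chi_def dot_real inner_commute field_simps)
  then show ?thesis using finite_form_sublevel[OF assms] finite_subset by blast
qed

lemma finite_q_exponent_fibre:
  assumes "negative_definite (plumbing_matrix adj m)"
  shows "finite {x. q_exponent adj m k x = a}"
proof -
  let ?M = "plumbing_matrix adj m"
  let ?b = "real_mat ?M *v real_vec 1 - real_vec k"
  have "{x. q_exponent adj m k x = a} \<subseteq>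
      {x. real_vec x \<bullet> ?b - real_of_int (form ?M x x) \<le> a - Delta adj m k}"
    by (auto simp: q_exponent_def chi_def dot_real form_real inner_commute inner_diff_right field_simps)
  then show ?thesis using finite_form_sublevel[OF assms] finite_subset by blast
qed

lemma eventual_value_eqI:
  assumes "F \<noteq> bot" "\<forall>\<^sub>F x in F. f x = c"
  shows "eventual_value F f = c"
  unfolding eventual_value_def
proof (rule the_equality)
  fix c' assume "\<forall>\<^sub>F x in F. f x = c'"
  with assms(2) have "\<forall>\<^sub>F x in F. c = c'" by eventually_elim auto
  then show "c' = c" using assms(1) by (simp add: eventually_const)
qed fact

lemma Z_hat_hat_partial_eventually:
  assumes "negative_definite (plumbing_matrix adj m)"
  shows "\<forall>\<^sub>F n in sequentially. Z_hat_hat_partial adj m k n a b =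
           (\<Sum>x | q_exponent adj m k x = a \<and> t_exponent adj m k x = b. F_plumbing adj m k x)"
proof -
  let ?S = "{x. q_exponent adj m k x = a \<and> t_exponent adj m k x = b}"
  have fin: "finite ?S" using finite_q_exponent_fibre[OF assms, of k a] by (rule rev_finite_subset) auto
  have "\<forall>\<^sub>F n in sequentially. \<forall>x\<in>?S. chi adj m k x \<le> real n"
    using fin filterlim_real_sequentially
    by (intro eventually_ball_finite ballI) (auto simp: filterlim_at_top)
  then show ?thesis
    by eventually_elim (auto simp: Z_hat_hat_partial_def intro!: sum.cong)
qed

lemma Z_hat_hat_rep_eq:
  assumes "negative_definite (plumbing_matrix adj m)"
  shows "Z_hat_hat_rep adj m k a b =
           (\<Sum>x | q_exponent adj m k x = a \<and> t_exponent adj m k x = b. F_plumbing adj m k x)"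
  unfolding Z_hat_hat_rep_def
  by (intro eventual_value_eqI Z_hat_hat_partial_eventually assms) simp

lemma form_add_left: "form A (x + y) z = form A x z + form A y z"
  by (simp add: form_def dot_def algebra_simps sum.distrib)

lemma form_add_right: "form A x (y + z) = form A x y + form A x z"
  by (simp add: form_def dot_def algebra_simps sum.distrib matrix_vector_right_distrib)

lemma Z_hat_hat_rep_coset:
  assumes adj: "symp adj" and nd: "negative_definite (plumbing_matrix adj m)"
    and "k' \<in> coset2 (plumbing_matrix adj m) k"
  shows "Z_hat_hat_rep adj m k' = Z_hat_hat_rep adj m k"
proof -
  let ?M = "plumbing_matrix adj m"
  obtain n where k': "k' = k + 2 *s (?M *v n)" using assms(3) by (auto simp: coset2_def)
  have tr: "transpose (real_mat ?M) = real_mat ?M"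
    using sympD[OF adj] by (auto simp: vec_eq_iff transpose_def real_mat_def map_matrix_def plumbing_matrix_def)
  have sym: "form ?M x y = form ?M y x" for x y
  proof -
    have "real_of_int (form ?M x y) = real_of_int (form ?M y x)"
      unfolding form_real by (metis dot_lmul_matrix inner_commute tr transpose_matrix_vector)
    then show ?thesis by simp
  qed
  have inv: "invertible (real_mat ?M)"
  proof -
    have "real_mat ?M *v x = 0 \<Longrightarrow> x = 0" for x
      using nd unfolding negative_definite_def by (metis inner_zero_right less_irrefl)
    then show ?thesis using matrix_left_invertible_ker invertible_left_inverse by blast
  qed
  have dotk: "k' \<cdot> y = k \<cdot> y + 2 * form ?M y n" for y
    by (simp add: k' dot_def form_def algebra_simps sum.distrib sum_distrib_left)
  let ?w = "k - ?M *v 1"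
  have inv_eqs: "matrix_inv (real_mat ?M) ** real_mat ?M = mat 1"
    "real_mat ?M ** matrix_inv (real_mat ?M) = mat 1"
    using someI_ex[OF inv[unfolded invertible_def]] by (auto simp: matrix_inv_def)
  have invn: "matrix_inv (real_mat ?M) *v (real_mat ?M *v y) = y" for y
    by (simp add: matrix_vector_mul_assoc inv_eqs)
  have "real_vec (k' - ?M *v 1) = real_vec ?w + 2 *\<^sub>R (real_mat ?M *v real_vec n)"
    by (simp add: k' real_vec_mult[symmetric]) (simp add: real_vec_def vec_eq_iff)
  then have "inv_square ?M (k' - ?M *v 1) =
      inv_square ?M ?w + 2 * (real_vec ?w \<bullet> real_vec n)
      + 2 * ((real_mat ?M *v real_vec n) \<bullet> (matrix_inv (real_mat ?M) *v real_vec ?w))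
      + 4 * ((real_mat ?M *v real_vec n) \<bullet> real_vec n)"
    by (simp add: inv_square_def matrix_vector_right_distrib matrix_vector_mult_scaleR invn
        inner_add_left inner_add_right)
  moreover have "(real_mat ?M *v real_vec n) \<bullet> (matrix_inv (real_mat ?M) *v real_vec ?w)
      = real_vec n \<bullet> real_vec ?w"
  proof -
    have "(real_mat ?M *v real_vec n) \<bullet> y = real_vec n \<bullet> (real_mat ?M *v y)" for y
      by (metis dot_lmul_matrix tr transpose_matrix_vector)
    then show ?thesis by (simp add: matrix_vector_mul_assoc inv_eqs)
  qed
  moreover have "real_vec ?w \<bullet> real_vec n = real_of_int (k \<cdot> n - form ?M n 1)"
    unfolding dot_real[symmetric] by (simp add: dot_def form_def algebra_simps sum_subtractf)
  ultimately have sq: "inv_square ?M (k' - ?M *v 1) =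
      inv_square ?M ?w + 4 * real_of_int (k \<cdot> n - form ?M n 1 + form ?M n n)"
    by (simp add: form_real inner_commute)
  have F: "F_plumbing adj m k' x = F_plumbing adj m k (x + n)" for x
    by (simp add: F_plumbing_def k' matrix_vector_right_distrib vector_add_ldistrib algebra_simps)
  have q: "q_exponent adj m k' x = q_exponent adj m k (x + n)" for x
    by (simp add: q_exponent_def Delta_def sq chi_def dotk form_add_left form_add_right sym[of n x])
      (simp add: dot_def algebra_simps sum.distrib add_divide_distrib diff_divide_distrib)
  have t: "t_exponent adj m k' x = t_exponent adj m k (x + n)" for x
    by (simp add: t_exponent_def Theta_def dotk form_add_left sym[of n 1] field_simps)
  show ?thesis
  proof (intro ext)
    fix a b
    show "Z_hat_hat_rep adj m k' a b = Z_hat_hat_rep adj m k a b"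
      unfolding Z_hat_hat_rep_eq[OF nd]
      by (rule sum.reindex_bij_witness[of _ "\<lambda>x. x - n" "\<lambda>x. x + n"]) (auto simp: F q t)
  qed
qed

lemma Z_hat_hat_coset:
  assumes "symp adj" "negative_definite (plumbing_matrix adj m)"
  shows "Z_hat_hat adj m (coset2 (plumbing_matrix adj m) k) = Z_hat_hat_rep adj m k"
proof -
  have "k \<in> coset2 (plumbing_matrix adj m) k" by (auto simp: coset2_def intro!: exI[of _ 0])
  then show ?thesis
    unfolding Z_hat_hat_def by (intro Z_hat_hat_rep_coset assms) (rule someI)
qed

end

theory Submission
  imports Defs
begin

text \<open>
  Write \<open>M\<close> for the plumbing matrix, \<open>u = (1, \<dots>, 1)\<close> and \<open>\<ell>\<^sub>k(x) = 2 M x + k - M u\<close>. All three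
  ingredients of the two-variable series are simple in terms of \<open>\<ell>\<^sub>k(x)\<close>: the coefficient is
  \<open>\<Prod>\<^sub>v F(\<ell>\<^sub>k(x)\<^sub>v)\<close>, where \<open>F\<close> is the function attached to the degree of \<open>v\<close>; completing the square,
  the exponent of \<open>q\<close> is \<open>- (3 s + \<Sum>\<^sub>v m\<^sub>v) / 4 - \<ell>\<^sub>k(x)\<^sup>t M\<^sup>-\<^sup>1 \<ell>\<^sub>k(x) / 4\<close> (\<open>q_exponent_ell\<close>);
  and the exponent of \<open>t\<close> is \<open>u \<cdot> \<ell>\<^sub>k(x) / 2\<close>.

  The affine involution \<open>x \<mapsto> u - x\<close> satisfies \<open>\<ell>\<^sub>-\<^sub>k(u - x) = - \<ell>\<^sub>k(x)\<close>. It therefore preserves the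
  exponent of \<open>q\<close> and negates that of \<open>t\<close>. As \<open>F\<close> at a vertex of degree \<open>\<delta>\<close> has parity
  \<open>(- 1)\<^sup>\<delta>\<close> (\<open>F_hat_minus\<close>), the coefficient is multiplied by \<open>- 1\<close> to the power of the sum
  of all degrees, which is even. This gives the symmetry under conjugation together with
  \<open>t \<mapsto> t\<^sup>-\<^sup>1\<close> (\<open>Z_hat_hat_rep_conjugate\<close>).

  At \<open>t = 1\<close>, the sum over \<open>x\<close> becomes a sum over \<open>\<ell> = \<ell>\<^sub>k(x)\<close>, which runs injectively through the
  coset \<open>k - M u + 2 M \<int>\<^sup>s\<close>. What remains to be seen is that the principal value integral is
  equal to \<open>F(\<ell>\<^sub>v)\<close> (\<open>principal_value_coeff_eq\<close>). Inside the unit circle, the integral is a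
  residue at the origin, hence a coefficient of the Laurent expansion of \<open>(z - z\<^sup>-\<^sup>1)\<^sup>2\<^sup>-\<^sup>\<delta>\<close> there.
  The substitution \<open>z \<mapsto> z\<^sup>-\<^sup>1\<close> reduces the integrals outside to those inside.
\<close>

section \<open>Coefficients and contour integrals\<close>

lemma odd_series_mult: "odd_series * (fls_X_inv - fls_X) = 1"
proof (rule fls_eqI)
  fix i :: int
  have "fls_nth odd_series j = (if j > 0 \<and> odd j then 1 else 0)" for j
    by (auto simp: odd_series_def even_nat_iff)
  then show "fls_nth (odd_series * (fls_X_inv - fls_X)) i = fls_nth 1 i"
    by (auto simp: ring_distribs fls_X_inv_times_conv_shift fls_X_times_conv_shift)
qed

lemma inverse_X_minus_X_inv: "inverse (fls_X - fls_X_inv :: complex fls) = - odd_series"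
  using odd_series_mult by (intro inverse_unique) (simp add: algebra_simps)

lemma nth_X_minus_X_inv_power_minus:
  assumes "d \<le> 2"
  shows "fls_nth ((fls_X - fls_X_inv) ^ d) (- r) =
           (- 1) ^ d * (fls_nth ((fls_X - fls_X_inv) ^ d) r :: complex)"
proof -
  consider "d = 0" | "d = 1" | "d = 2" using assms by linarith
  moreover have "fls_nth (2 :: complex fls) r = fls_nth 2 (- r)" by (cases "r = 0") auto
  ultimately show ?thesis
    by cases (auto simp: power2_eq_square algebra_simps fls_X_inv_times_conv_shift
        fls_X_times_conv_shift)
qed

lemma nth_minus_odd_series_power:
  "fls_nth ((- odd_series) ^ p) r = (- 1) ^ p * fls_nth (odd_series ^ p) r"
  by (cases "even p") auto

text \<open>
  The parity of \<open>(z - z\<^sup>-\<^sup>1)\<^sup>2\<^sup>-\<^sup>n\<close> under \<open>z \<mapsto> z\<^sup>-\<^sup>1\<close>. For \<open>n > 2\<close> this substitution exchanges the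
  two expansions that are averaged.
\<close>
lemma F_hat_minus: "F_hat n (- r) = (- 1) ^ n * F_hat n r"
proof (cases "n \<le> 2")
  case True
  have "(- 1 :: complex) ^ (2 - n) = (- 1) ^ n" using True by (auto simp: uminus_power_if)
  then show ?thesis
    using True nth_X_minus_X_inv_power_minus[of "2 - n" "- r"] by (simp add: F_hat_def)
next
  case False
  have "(- 1 :: complex) ^ (n - 2) = (- 1) ^ n" using False by (auto simp: uminus_power_if)
  then show ?thesis
    using False by (auto simp: F_hat_def nth_minus_odd_series_power uminus_power_if)
qed

text \<open>
  The integral over \<open>|z| = r\<close>, normalised so that for \<open>0 < r \<noteq> 1\<close> it is the coefficient of \<open>z\<^sup>-\<^sup>l\<close>
  in the expansion of \<open>(z - z\<^sup>-\<^sup>1)\<^sup>2\<^sup>-\<^sup>n\<close> on \<open>0 < |z| < 1\<close> or on \<open>|z| > 1\<close>, whichever contains this circle.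
\<close>
definition circle_coeff :: "nat \<Rightarrow> int \<Rightarrow> real \<Rightarrow> complex" where
  "circle_coeff n l r = 1 / (2 * of_real pi * \<i>) *
     contour_integral (circlepath 0 r) (\<lambda>z. 1 / z * (z - 1 / z) powi (2 - int n) * z powi l)"

lemma circle_coeff_inside:
  assumes "0 < r" "r < 1"
  shows "circle_coeff n l r = fls_nth ((fls_X - fls_X_inv) powi (2 - int n)) (- l)"
proof -
  let ?f = "\<lambda>z::complex. 1 / z * (z - 1 / z) powi (2 - int n) * z powi l"
  let ?P = "(fls_X - fls_X_inv :: complex fls) powi (2 - int n)"
  have nz: "z - 1 / z \<noteq> 0" if "z \<noteq> 0" "norm z < 1" for z :: complex
  proof
    assume "z - 1 / z = 0"
    then have "z ^ 2 = 1" using that(1) by (simp add: field_simps power2_eq_square)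
    then show False using that(2) by (auto simp: power2_eq_1_iff)
  qed
  have "(?f has_contour_integral 2 * pi * \<i> * residue ?f 0) (circlepath 0 r)"
  proof (rule base_residue[where s = "ball 0 1"])
    show "?f holomorphic_on ball 0 1 - {0}"
      using nz by (intro holomorphic_intros) auto
  qed (use assms in auto)
  moreover have "residue ?f 0 =
      fls_residue (1 / fls_X * (fls_X - 1 / fls_X) powi (2 - int n) * fls_X powi l)"
    by (intro has_laurent_expansion_residue_0 laurent_expansion_intros)
  moreover have "1 / fls_X * (fls_X - 1 / fls_X) powi (2 - int n) * fls_X powi l
      = fls_shift (1 - l) ?P"
    unfolding divide_inverse mult_1_left fls_inverse_X fls_X_inv_conv_shift_1[symmetric]
      fls_X_power_int fls_X_inv_times_conv_shift
      fls_X_intpow_times_conv_shift by (simp add: algebra_simps)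
  ultimately show ?thesis
    by (simp add: circle_coeff_def contour_integral_unique)
qed

text \<open>
  The substitution \<open>z \<mapsto> z\<^sup>-\<^sup>1\<close> exchanges the two sides of the unit circle. The sign arises because
  it negates \<open>z - z\<^sup>-\<^sup>1\<close>.
\<close>
lemma circle_coeff_inverse_radius:
  assumes "r > 0"
  shows "circle_coeff n l r = (- 1) ^ n * circle_coeff n (- l) (1 / r)"
proof -
  \<comment> \<open>Since \<open>dz / z = 2 \<pi> \<i> dt\<close> along the circle, the coefficient is the mean value of \<open>G l\<close>.\<close>
  define G where "G l z = (z - 1 / z) powi (2 - int n) * z powi l" for l and z :: complex
  define e where "e t = exp (2 * of_real pi * \<i> * of_real t)" for t :: real
  have circ: "circle_coeff n l r = integral {0..1} (\<lambda>t. G l (of_real r * e t))"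
    if "r > 0" for l r
  proof -
    have "contour_integral (circlepath 0 r) (\<lambda>z. 1 / z * (z - 1 / z) powi (2 - int n) * z powi l)
        = integral {0..1} (\<lambda>t. (2 * of_real pi * \<i>) * G l (of_real r * e t))"
      unfolding contour_integral_integral
    proof (rule integral_cong)
      fix t :: real assume "t \<in> {0..1}"
      have "circlepath 0 r t = of_real r * e t"
        by (simp add: circlepath e_def)
      moreover have "vector_derivative (circlepath 0 r) (at t) =
          2 * of_real pi * \<i> * (of_real r * e t)"
        by (simp add: vector_derivative_circlepath e_def)
      moreover have "of_real r * e t \<noteq> 0" using that by (simp add: e_def)
      ultimately show "1 / circlepath 0 r t * (circlepath 0 r t - 1 / circlepath 0 r t) powi (2 - int n)
            * circlepath 0 r t powi l * vector_derivative (circlepath 0 r) (at t)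
          = 2 * of_real pi * \<i> * G l (of_real r * e t)"
        by (simp add: G_def)
    qed
    then show ?thesis by (simp add: circle_coeff_def)
  qed
  have G_inv: "G l (1 / z) = (- 1) ^ n * G (- l) z" for z
  proof -
    have "1 / z - 1 / (1 / z) = - 1 * (z - 1 / z)" by simp
    moreover have "(- 1 :: complex) powi (2 - int n) = (- 1) ^ n"
      by (auto simp: power_int_minus_left uminus_power_if)
    ultimately have "(1 / z - 1 / (1 / z)) powi (2 - int n) = (- 1) ^ n * (z - 1 / z) powi (2 - int n)"
      by (simp only: power_int_mult_distrib)
    moreover have "(1 / z) powi l = z powi (- l)"
      by (simp add: power_int_minus power_int_one_over divide_inverse power_int_inverse)
    ultimately show ?thesis by (simp only: G_def mult.assoc)
  qed
  have e_refl: "e (1 - t) = 1 / e t" for t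
    by (simp add: e_def exp_diff ring_distribs)
  have "circle_coeff n l r = integral {0..1} (\<lambda>t. G l (of_real r * e t))"
    by (rule circ) fact
  also have "\<dots> = integral {0..1} (\<lambda>t. G l (of_real r * e (1 - t)))"
  proof -
    have "integral {0..1} (\<lambda>t. f (1 - t)) = integral {0..1} f" for f :: "real \<Rightarrow> complex"
      using Henstock_Kurzweil_Integration.integral_reflect_real[of 1 0 "\<lambda>t. f (1 - t)"]
        integral_shift_Icc_real[of "-1" 0 f 1]
      by (simp add: o_def)
    then show ?thesis by (rule sym)
  qed
  also have "\<dots> = integral {0..1} (\<lambda>t. (- 1) ^ n * G (- l) (of_real (1 / r) * e t))"
  proof (rule integral_cong)
    fix t
    have "of_real r * e (1 - t) = 1 / (of_real (1 / r) * e t)"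
      using assms by (simp add: e_refl)
    then show "G l (of_real r * e (1 - t)) = (- 1) ^ n * G (- l) (of_real (1 / r) * e t)"
      by (simp only: G_inv)
  qed
  also have "\<dots> = (- 1) ^ n * circle_coeff n (- l) (1 / r)"
    using assms by (simp add: circ)
  finally show ?thesis .
qed

lemma principal_value_coeff_eq: "principal_value_coeff n l = F_hat n l"
proof -
  let ?c = "\<lambda>l. fls_nth ((fls_X - fls_X_inv) powi (2 - int n)) l :: complex"
  have "(circle_coeff n l (1 + \<epsilon>) + circle_coeff n l (1 - \<epsilon>)) / 2 = F_hat n l"
    if "0 < \<epsilon>" "\<epsilon> < 1" for \<epsilon>
  proof -
    have "circle_coeff n l (1 + \<epsilon>) = (- 1) ^ n * ?c l"
      using that circle_coeff_inverse_radius[of "1 + \<epsilon>" n l] by (simp add: circle_coeff_inside)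
    moreover have "circle_coeff n l (1 - \<epsilon>) = ?c (- l)"
      using that by (simp add: circle_coeff_inside)
    moreover have "((- 1) ^ n * ?c l + ?c (- l)) / 2 = F_hat n l"
    proof (cases "n \<le> 2")
      case True
      then have *: "?c j = F_hat n (- j)" for j
        by (simp add: F_hat_def power_int_def nat_diff_distrib)
      then show ?thesis by (simp only: *) (simp add: F_hat_minus)
    next
      case False
      then have *: "?c j = fls_nth ((- odd_series) ^ (n - 2)) j" for j
        by (simp add: power_int_def inverse_X_minus_X_inv nat_diff_distrib)
      have "(- 1) ^ n * ?c l = fls_nth (odd_series ^ (n - 2)) l"
        using False unfolding * nth_minus_odd_series_power by (auto simp: uminus_power_if)
      then show ?thesis using False by (simp add: F_hat_def *)
    qed
    ultimately show ?thesis by simp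
  qed
  then have "\<forall>\<^sub>F \<epsilon> in at_right (0::real).
      (circle_coeff n l (1 + \<epsilon>) + circle_coeff n l (1 - \<epsilon>)) / 2 = F_hat n l"
    by (auto simp: eventually_at_right[of 0 1] intro!: exI[of _ 1])
  then have "eventual_value (at_right (0::real))
      (\<lambda>\<epsilon>. (circle_coeff n l (1 + \<epsilon>) + circle_coeff n l (1 - \<epsilon>)) / 2) = F_hat n l"
    by (intro eventual_value_eqI) auto
  then show ?thesis
    by (simp only: principal_value_coeff_def circle_coeff_def Let_def of_real_add of_real_diff)
qed

section \<open>The form of a plumbing graph\<close>

lemma transpose_plumbing_matrix:
  assumes "symp adj"
  shows "transpose (real_mat (plumbing_matrix adj m)) = real_mat (plumbing_matrix adj m)"
  using sympD[OF assms]
  by (auto simp: vec_eq_iff transpose_def real_mat_def map_matrix_def plumbing_matrix_def)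

lemma self_adjoint_inner:
  fixes A :: "real^'v^'v"
  assumes "transpose A = A"
  shows "(A *v x) \<bullet> y = x \<bullet> (A *v y)"
  by (metis assms dot_lmul_matrix transpose_matrix_vector)

lemma negative_definite_mult_eq_0:
  assumes "negative_definite A" "real_mat A *v x = 0"
  shows "x = 0"
  using assms unfolding negative_definite_def by (metis inner_zero_right less_irrefl)

lemma negative_definite_matrix_inv:
  assumes "negative_definite A"
  shows "matrix_inv (real_mat A) ** real_mat A = mat 1"
    and "real_mat A ** matrix_inv (real_mat A) = mat 1"
proof -
  have "invertible (real_mat A)"
    using negative_definite_mult_eq_0[OF assms] matrix_left_invertible_ker invertible_left_inverse
    by blast
  from someI_ex[OF this[unfolded invertible_def]]
  show "matrix_inv (real_mat A) ** real_mat A = mat 1"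
    and "real_mat A ** matrix_inv (real_mat A) = mat 1"
    by (auto simp: matrix_inv_def)
qed

lemma inv_square_minus:
  fixes A :: "int^'v^'v"
  shows "inv_square A (- y) = inv_square A y"
proof -
  have "real_vec (- y) = - real_vec y" by (simp add: real_vec_def vec_eq_iff)
  moreover have "B *v (- z) = - (B *v z)" for B :: "real^'v^'v" and z
    using matrix_vector_mult_scaleR[of B "-1" z] by simp
  ultimately show ?thesis by (simp add: inv_square_def)
qed

lemma inv_square_shift:
  assumes "negative_definite A" "transpose (real_mat A) = real_mat A"
  shows "inv_square A (2 *s (A *v x) + y) =
           inv_square A y + 4 * real_of_int (x \<cdot> y) + 4 * real_of_int (form A x x)"
proof -
  note inv = negative_definite_matrix_inv[OF assms(1)]
  have "real_vec (2 *s (A *v x) + y) = 2 *\<^sub>R (real_mat A *v real_vec x) + real_vec y"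
    by (simp add: real_vec_mult[symmetric]) (simp add: real_vec_def vec_eq_iff)
  moreover have "matrix_inv (real_mat A) *v (real_mat A *v z) = z" for z
    by (simp add: matrix_vector_mul_assoc inv)
  moreover have "(real_mat A *v real_vec x) \<bullet> (matrix_inv (real_mat A) *v real_vec y)
      = real_vec x \<bullet> real_vec y"
    by (simp add: self_adjoint_inner[OF assms(2)] matrix_vector_mul_assoc inv)
  ultimately show ?thesis
    by (simp add: inv_square_def matrix_vector_right_distrib matrix_vector_mult_scaleR
        inner_add_left inner_add_right dot_real form_real self_adjoint_inner[OF assms(2)] inner_commute)
qed

lemma even_double_sum:
  fixes a :: "'a \<Rightarrow> 'a \<Rightarrow> nat"
  assumes "finite A" "\<And>v w. a v w = a w v" "\<And>v. a v v = 0"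
  shows "even (\<Sum>v\<in>A. \<Sum>w\<in>A. a v w)"
  using assms(1)
proof (induction rule: finite_induct)
  case (insert x A)
  have "(\<Sum>v\<in>insert x A. \<Sum>w\<in>insert x A. a v w) =
      2 * (\<Sum>w\<in>A. a x w) + (\<Sum>v\<in>A. \<Sum>w\<in>A. a v w)"
    using insert.hyps assms(2)[of _ x] by (simp add: assms(3) sum.distrib)
  then show ?case using insert.IH by simp
qed simp

text \<open>The handshake lemma: every edge contributes to the degrees of two vertices.\<close>
lemma even_sum_vertex_degree:
  assumes "symp adj" "irreflp adj"
  shows "even (\<Sum>v\<in>UNIV. vertex_degree adj v)"
proof -
  have "(\<Sum>v\<in>UNIV. vertex_degree adj v) = (\<Sum>v\<in>UNIV. \<Sum>w\<in>UNIV. of_bool (adj v w))"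
    by (simp add: vertex_degree_def)
  moreover have "even (\<Sum>v\<in>UNIV. \<Sum>w\<in>UNIV. of_bool (adj v w) :: nat)"
  proof (rule even_double_sum)
    fix v w
    have "adj v w \<longleftrightarrow> adj w v" using assms(1) by (blast dest: sympD)
    then show "(of_bool (adj v w) :: nat) = of_bool (adj w v)" by simp
    show "(of_bool (adj v v) :: nat) = 0" using assms(2) by (simp add: irreflp_def)
  qed simp
  ultimately show ?thesis by simp
qed

section \<open>Conjugation\<close>

text \<open>The vector \<open>\<ell>\<^sub>k(x) = 2 M x + k - M u\<close>, as a function of \<open>x\<close>.\<close>
definition ell :: "('v::finite \<Rightarrow> 'v \<Rightarrow> bool) \<Rightarrow> int^'v \<Rightarrow> int^'v \<Rightarrow> int^'v \<Rightarrow> int^'v" where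
  "ell adj m k x =
     2 *s (plumbing_matrix adj m *v x) + (k - plumbing_matrix adj m *v 1)"

lemma F_plumbing_ell:
  "F_plumbing adj m k x = (\<Prod>v\<in>UNIV. F_hat (vertex_degree adj v) (ell adj m k x $ v))"
  by (simp add: F_plumbing_def ell_def algebra_simps)

lemma ell_conjugate: "ell adj m (- k) (1 - x) = - ell adj m k x"
  by (simp add: ell_def matrix_vector_mult_diff_distrib vec_eq_iff algebra_simps)

lemma F_plumbing_conjugate:
  assumes "symp adj" "irreflp adj"
  shows "F_plumbing adj m (- k) (1 - x) = F_plumbing adj m k x"
proof -
  have "(\<Prod>v\<in>UNIV. (- 1 :: complex) ^ vertex_degree adj v) = 1"
    using even_sum_vertex_degree[OF assms] by (simp add: power_sum[symmetric])
  then show ?thesis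
    by (simp add: F_plumbing_ell ell_conjugate F_hat_minus prod.distrib)
qed

lemma q_exponent_ell:
  fixes adj :: "'v::finite \<Rightarrow> 'v \<Rightarrow> bool"
  assumes "symp adj" "negative_definite (plumbing_matrix adj m)"
  shows "q_exponent adj m k x =
           - (3 * real CARD('v) + (\<Sum>v\<in>UNIV. real_of_int (m $ v))) / 4
           - inv_square (plumbing_matrix adj m) (ell adj m k x) / 4"
proof -
  have "x \<cdot> (k - plumbing_matrix adj m *v 1) = k \<cdot> x - form (plumbing_matrix adj m) x 1"
    by (simp add: dot_def form_def algebra_simps sum_subtractf)
  then show ?thesis
    by (simp add: q_exponent_def Delta_def chi_def ell_def
        inv_square_shift[OF assms(2) transpose_plumbing_matrix[OF assms(1)]]
        add_divide_distrib diff_divide_distrib)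
qed

lemma q_exponent_conjugate:
  assumes "symp adj" "negative_definite (plumbing_matrix adj m)"
  shows "q_exponent adj m (- k) (1 - x) = q_exponent adj m k x"
  by (simp add: q_exponent_ell[OF assms] ell_conjugate inv_square_minus)

lemma t_exponent_conjugate: "t_exponent adj m (- k) (1 - x) = - t_exponent adj m k x"
proof -
  have "form (plumbing_matrix adj m) (1 - x) 1
      = form (plumbing_matrix adj m) 1 1 - form (plumbing_matrix adj m) x 1"
    by (simp add: eq_diff_eq flip: form_add_left)
  moreover have "(- k) \<cdot> 1 = - (k \<cdot> 1)" by (simp add: dot_def sum_negf)
  ultimately show ?thesis
    by (simp add: t_exponent_def Theta_def field_simps)
qed

lemma Z_hat_hat_rep_conjugate:
  assumes "symp adj" "irreflp adj" and nd: "negative_definite (plumbing_matrix adj m)"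
  shows "Z_hat_hat_rep adj m k a b = Z_hat_hat_rep adj m (- k) a (- b)"
proof -
  note conj = q_exponent_conjugate[OF assms(1) nd] t_exponent_conjugate
    F_plumbing_conjugate[OF assms(1,2)]
  have reverse: "q_exponent adj m k (1 - x) = q_exponent adj m (- k) x"
    "t_exponent adj m k (1 - x) = - t_exponent adj m (- k) x" for x
    using conj(1)[of "- k" x] conj(2)[of adj m "- k" x] by simp_all
  show ?thesis
    unfolding Z_hat_hat_rep_eq[OF nd]
    by (rule sum.reindex_bij_witness[of _ "\<lambda>x. 1 - x" "\<lambda>x. 1 - x"]) (auto simp: conj reverse)
qed

section \<open>Specialisation at \<open>t = 1\<close>\<close>

lemma subst_t_one_Z_hat_hat_rep:
  assumes "negative_definite (plumbing_matrix adj m)"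
  shows "subst_t_one (Z_hat_hat_rep adj m k) a =
           (\<Sum>x | q_exponent adj m k x = a. F_plumbing adj m k x)"
proof -
  let ?X = "{x. q_exponent adj m k x = a}"
  let ?Z = "Z_hat_hat_rep adj m k a"
  have fin: "finite ?X" by (rule finite_q_exponent_fibre[OF assms])
  have Z: "?Z b = (\<Sum>x\<in>{x\<in>?X. t_exponent adj m k x = b}. F_plumbing adj m k x)" for b
    by (simp add: Z_hat_hat_rep_eq[OF assms])
  \<comment> \<open>Only finitely many powers of \<open>t\<close> occur with \<open>q\<^sup>a\<close>, so the substitution is a finite sum.\<close>
  have "{b. ?Z b \<noteq> 0} \<subseteq> t_exponent adj m k ` ?X"
  proof
    fix b assume "b \<in> {b. ?Z b \<noteq> 0}"
    then have "{x\<in>?X. t_exponent adj m k x = b} \<noteq> {}"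
      unfolding Z by (metis (mono_tags) mem_Collect_eq sum.empty)
    then show "b \<in> t_exponent adj m k ` ?X" by auto
  qed
  then have "subst_t_one (Z_hat_hat_rep adj m k) a = (\<Sum>b\<in>t_exponent adj m k ` ?X. ?Z b)"
    unfolding subst_t_one_def using fin by (intro sum.mono_neutral_left) auto
  also have "\<dots> = (\<Sum>x\<in>?X. F_plumbing adj m k x)"
    unfolding Z by (rule sum.image_gen[symmetric, OF fin])
  finally show ?thesis .
qed

lemma inj_ell:
  assumes "negative_definite (plumbing_matrix adj m)"
  shows "inj (ell adj m k)"
proof (rule injI)
  fix x y assume "ell adj m k x = ell adj m k y"
  then have "plumbing_matrix adj m *v (x - y) = 0"
    by (simp add: ell_def vec_eq_iff matrix_vector_mult_diff_distrib)
  then have "real_mat (plumbing_matrix adj m) *v real_vec (x - y) = 0"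
    by (simp flip: real_vec_mult) (simp add: real_vec_def vec_eq_iff)
  then have "real_vec (x - y) = 0" by (rule negative_definite_mult_eq_0[OF assms])
  then show "x = y" by (simp add: real_vec_def vec_eq_iff)
qed

lemma Z_hat_eq_sum:
  fixes adj :: "'v::finite \<Rightarrow> 'v \<Rightarrow> bool"
  assumes "symp adj" "negative_definite (plumbing_matrix adj m)"
  shows "Z_hat adj m (k - plumbing_matrix adj m *v 1) a =
           (\<Sum>x | q_exponent adj m k x = a. F_plumbing adj m k x)"
proof -
  have "coset2 (plumbing_matrix adj m) (k - plumbing_matrix adj m *v 1) = range (ell adj m k)"
    by (auto simp: coset2_def ell_def add.commute)
  then have "{l. l \<in> coset2 (plumbing_matrix adj m) (k - plumbing_matrix adj m *v 1) \<and>
       - (3 * real CARD('v) + (\<Sum>v\<in>UNIV. real_of_int (m $ v))) / 4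
       - inv_square (plumbing_matrix adj m) l / 4 = a} = ell adj m k ` {x. q_exponent adj m k x = a}"
    by (auto simp: q_exponent_ell[OF assms])
  then show ?thesis
    unfolding Z_hat_def
    by (simp add: sum.reindex inj_on_subset[OF inj_ell[OF assms(2)]] F_plumbing_ell
        principal_value_coeff_eq)
qed

lemma subst_t_one_subst_t_inverse: "subst_t_one (subst_t_inverse Z) = subst_t_one Z"
  unfolding subst_t_one_def subst_t_inverse_def
  by (intro ext sum.reindex_bij_witness[of _ uminus uminus]) auto

theorem corollary8p2:
  fixes adj :: "'v::finite \<Rightarrow> 'v \<Rightarrow> bool" and m k :: "int^'v"
  assumes "tree_adjacency adj"
    and "negative_definite (plumbing_matrix adj m)"
    and "k \<in> characteristic_vectors m"
  shows "Z_hat_hat adj m (coset2 (plumbing_matrix adj m) k) =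
           subst_t_inverse (Z_hat_hat adj m (coset2 (plumbing_matrix adj m) (- k))) \<and>
         subst_t_one (Z_hat_hat adj m (coset2 (plumbing_matrix adj m) k)) =
           Z_hat adj m (k - plumbing_matrix adj m *v 1) \<and>
         Z_hat adj m (k - plumbing_matrix adj m *v 1) =
           Z_hat adj m (- k - plumbing_matrix adj m *v 1)"
proof -
  have adj: "symp adj" "irreflp adj" using assms(1) by (auto simp: tree_adjacency_def)
  let ?Z = "\<lambda>k. Z_hat_hat adj m (coset2 (plumbing_matrix adj m) k)"
  have rep: "?Z k = Z_hat_hat_rep adj m k" for k
    by (rule Z_hat_hat_coset[OF adj(1) assms(2)])
  have conj: "?Z k = subst_t_inverse (?Z (- k))"
    unfolding rep subst_t_inverse_def
    by (intro ext Z_hat_hat_rep_conjugate adj assms(2))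
  have one: "subst_t_one (?Z k) = Z_hat adj m (k - plumbing_matrix adj m *v 1)" for k
    unfolding rep
    by (intro ext) (simp add: subst_t_one_Z_hat_hat_rep[OF assms(2)] Z_hat_eq_sum[OF adj(1) assms(2)])
  have "Z_hat adj m (k - plumbing_matrix adj m *v 1) = subst_t_one (subst_t_inverse (?Z (- k)))"
    using one[of k] conj by simp
  also have "\<dots> = Z_hat adj m (- k - plumbing_matrix adj m *v 1)"
    by (simp only: subst_t_one_subst_t_inverse one)
  finally show ?thesis using conj one by blast
qed

end
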